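(* Let $s\mapsto\gamma(s)=(x(s),y(s),z(s),R(s))$ be a sub-Riemannian geodesic in $(SE(3),\Delta,\mathcal G_1)$ with $\lambda_6=0$ and $\lambda_1^2(0)+\lambda_2^2(0)+\lambda_3^2(0)\ne0$, departing from $e=(\mathbf 0,I)$, such that its spatial projection does not have (interior) cusps. Assume it departs from a cusp and ends towards a cusp, i.e. $\lambda_3(0)=0=\lambda_3(s_{max})$, where $s_{max}>0$ by definition. Then $z(s)>0$ for all $s\in(0,s_{max})$, and $$z(s)=0\iff\big(W=0\ \text{ and }\ s\in\{0,s_{max}\}\ \text{ and }\ \mathfrak c<1\big).$$
   Context: $SE(3)=\mathbb R^3\rtimes SO(3)$; $\Delta=\mathrm{span}\{\mathcal A_3,\mathcal A_4,\mathcal A_5\}$ with $\mathcal A_3,\mathcal A_4,\mathcal A_5$ the left-invariant vector fields generating translation along the $z$-axis and rotations about the $x$- and $y$-axis, orthonormal for $\mathcal G_1$. $\lambda_1,\dots,\lambda_6$ are the components of the momentum covector in the dual left-invariant frame. Geodesics $\gamma=(\mathbf x,R)$ from $e$ with $\lambda_6=0$ (normalized by $\lambda_3^2+\lambda_4^2+\lambda_5^2=1$) and spatial projection $\mathbf x=(x,y,z)$ without interior cusps are described in spatial arclength $s\in[0,s_{max}]$ as follows. The momentum is $\lambda_1(s)=\lambda_1(0)\cosh s-\lambda_5(0)\sinh s$, $\lambda_5(s)=\lambda_5(0)\cosh s-\lambda_1(0)\sinh s$, $\lambda_2(s)=\lambda_2(0)\cosh s+\lambda_4(0)\sinh s$,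 $\lambda_4(s)=\lambda_4(0)\cosh s+\lambda_2(0)\sinh s$, $\lambda_3(s)=\sqrt{1-\lambda_4(s)^2-\lambda_5(s)^2}$, with $\lambda_4(0)^2+\lambda_5(0)^2\le1$; $s_{max}$ is the minimal $s>0$ with $\lambda_3(s)=0$; $\lambda_3>0$ on $(0,s_{max})$; $\gamma(0)=(\mathbf 0,I)$ and for $0<s<s_{max}$ $$\mathbf x'(s)=R(s)\mathbf e_z,\qquad R'(s)=\frac1{\lambda_3(s)}R(s)\begin{pmatrix}0&0&\lambda_5(s)\\0&0&-\lambda_4(s)\\-\lambda_5(s)&\lambda_4(s)&0\end{pmatrix}.$$ First integrals (constant along the geodesic): $W=-\lambda_1\lambda_4-\lambda_2\lambda_5$, $\mathfrak c=\sqrt{\lambda_1^2+\lambda_2^2+\lambda_3^2}$.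
   Formalization: The equivalence is proved for s in (0, s_max]; at s = 0 only the direction "⇐" is stated, because z(0) = 0 always holds, so "z(0) = 0 implies W = 0 and c < 1" is false, e.g. for λ(0) = (1,1,0,0,1,0), where W = -1. *)

theory Defs
  imports "HOL-Analysis.Analysis"
begin

definition SE3 :: "((real^3) \<times> (real^3^3)) set" where
  "SE3 = UNIV \<times> {R. rotation_matrix R}"

definition so3_part :: "real^6 \<Rightarrow> real^3^3" where
  "so3_part l = vector [vector [0, 0, l$5],
                        vector [0, 0, - l$4],
                        vector [- l$5, l$4, 0]]"

text \<open>
  A covector \<open>l :: real^6\<close> holds the components of the momentum in the dual of the left-invariant
  frame; the index \<open>6\<close> of type \<open>6\<close> is \<open>0\<close>, so \<open>l$1, \<dots>, l$6\<close> are six distinct components.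

  \<open>cuspless_geodesic lam \<gamma> smax\<close>: \<open>\<gamma>\<close> is the spatial-arclength parametrization on \<open>{0..smax}\<close> of a
  sub-Riemannian geodesic departing from the unit element, with momentum \<open>lam\<close>, vanishing sixth
  component, and no cusp of the spatial projection before \<open>smax\<close>, the first positive time at which
  \<open>lam s$3 = 0\<close>. A cusp at time \<open>0\<close> is allowed. The equation for the rotation is singular wherever
  \<open>lam s$3 = 0\<close>, hence it is required only on the open interval, and the curve is required to be
  continuous on the closed one. With respect to arclength in space, the velocity of \<open>\<gamma>\<close> is
  \<open>A3 + (lam s$4 / lam s$3) A4 + (lam s$5 / lam s$3) A5\<close>, where \<open>A3\<close>, \<open>A4\<close>, \<open>A5\<close> are the
  left-invariant fields of translation along the z-axis and of rotation about the x- and y-axis.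
\<close>

definition cuspless_geodesic ::
  "(real \<Rightarrow> real^6) \<Rightarrow> (real \<Rightarrow> (real^3) \<times> (real^3^3)) \<Rightarrow> real \<Rightarrow> bool" where
  "cuspless_geodesic lam \<gamma> smax \<longleftrightarrow>
     (lam 0$4)\<^sup>2 + (lam 0$5)\<^sup>2 \<le> 1 \<and>
     (\<forall>s\<in>{0..smax}.
        lam s$1 = lam 0$1 * cosh s - lam 0$5 * sinh s \<and>
        lam s$5 = lam 0$5 * cosh s - lam 0$1 * sinh s \<and>
        lam s$2 = lam 0$2 * cosh s + lam 0$4 * sinh s \<and>
        lam s$4 = lam 0$4 * cosh s + lam 0$2 * sinh s \<and>
        lam s$3 = sqrt (1 - (lam s$4)\<^sup>2 - (lam s$5)\<^sup>2) \<and>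
        lam s$6 = 0) \<and>
     0 < smax \<and> lam smax$3 = 0 \<and> (\<forall>s\<in>{0<..<smax}. 0 < lam s$3) \<and>
     \<gamma> 0 = (0, mat 1) \<and>
     (\<forall>s\<in>{0..smax}. \<gamma> s \<in> SE3) \<and>
     continuous_on {0..smax} \<gamma> \<and>
     (\<forall>s\<in>{0<..<smax}.
        ((\<lambda>s. fst (\<gamma> s)) has_vector_derivative snd (\<gamma> s) *v axis 3 1) (at s) \<and>
        ((\<lambda>s. snd (\<gamma> s)) has_vector_derivative
           (1 / lam s$3) *\<^sub>R (snd (\<gamma> s) ** so3_part (lam s))) (at s))"

text \<open>
  Both functions are constant along the momentum of a geodesic, so they may be evaluated at any time.
\<close>

definition W_integral :: "real^6 \<Rightarrow> real" where
  "W_integral l = - l$1 * l$4 - l$2 * l$5"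

definition c_integral :: "real^6 \<Rightarrow> real" where
  "c_integral l = sqrt ((l$1)\<^sup>2 + (l$2)\<^sup>2 + (l$3)\<^sup>2)"

end

theory Submission
  imports Defs
begin

text \<open>
  Let \<open>p = (\<lambda>\<^sub>1, \<lambda>\<^sub>2, \<lambda>\<^sub>3)\<close>, \<open>v = (\<lambda>\<^sub>4, \<lambda>\<^sub>5, 0)\<close>, \<open>n = \<lambda>\<^sub>1\<lambda>\<^sub>5 - \<lambda>\<^sub>2\<lambda>\<^sub>4\<close>, and let \<open>r\<close> be the third row
  of \<open>R\<close>, a unit vector orthogonal to \<open>p\<close> with \<open>z' = r\<^sub>3\<close>. Conservation of linear and angular
  momentum gives \<open>c\<^sup>2 z = n(0) - r \<bullet> (p \<times> v)\<close>, and \<open>|p \<times> v|\<^sup>2 = n(0)\<^sup>2 - c\<^sup>2 \<lambda>\<^sub>3\<^sup>2\<close> because the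
  geodesic departs from a cusp; so \<open>z > 0\<close> between the cusps by Cauchy-Schwarz. At the end cusp
  \<open>n = - n(0)\<close>, hence \<open>c\<^sup>2 z = n(0) (1 + r\<^sub>3)\<close> vanishes iff \<open>r\<^sub>3 = - 1\<close>.

  If \<open>W > 0\<close> then \<open>y = r \<bullet> v\<close> and \<open>B = \<lambda>\<^sub>2 r\<^sub>1 - \<lambda>\<^sub>1 r\<^sub>2\<close> satisfy \<open>y' = B\<close>,
  \<open>B' = y + W r\<^sub>3 / \<lambda>\<^sub>3\<close> and \<open>(\<lambda>\<^sub>1\<^sup>2 + \<lambda>\<^sub>2\<^sup>2) y = W \<lambda>\<^sub>3 r\<^sub>3 - n B\<close>, which force \<open>y > 0\<close> at the end,
  whereas \<open>r\<^sub>3 = - 1\<close> would give \<open>r\<^sub>1 = r\<^sub>2 = 0\<close> and \<open>y = 0\<close>; \<open>W < 0\<close> is symmetric. If \<open>W = 0\<close> the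
  motion is planar and a further first integral gives \<open>r\<^sub>3 = \<plusminus>1\<close> at the end, with the sign decided
  by whether \<open>c < 1\<close>.
\<close>

section \<open>Real functions that are differentiable only inside an interval\<close>

text \<open>The geodesic equation is singular at cusps, so first integrals are differentiated only
  inside; continuity carries constancy to the ends.\<close>

lemma constant_on_closed_interval:
  fixes f :: "real \<Rightarrow> real"
  assumes "continuous_on {0..S} f"
    and "\<And>s. 0 < s \<Longrightarrow> s < S \<Longrightarrow> (f has_real_derivative 0) (at s)"
    and "0 \<le> s" "s \<le> S"
  shows "f s = f 0"
proof (cases "s = 0")
  case False
  then have "0 < s" using assms by simp
  show ?thesis
    by (rule DERIV_isconst_end[OF \<open>0 < s\<close>])
      (use assms in \<open>auto intro: continuous_on_subset\<close>)
qed simp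

text \<open>
  At a first zero of \<open>B\<close> the function \<open>y\<close> is already positive, so the algebraic relation makes
  \<open>A\<close>, and hence the derivative of \<open>B\<close>, positive there.
\<close>
lemma transversal_position_positive:
  fixes y B A l g n :: "real \<Rightarrow> real"
  assumes cont: "continuous_on {0..S} y" "continuous_on {0..S} B" "continuous_on {0..S} A"
    and init: "y 0 = 0" "B 0 = 0" "A 0 = 1"
    and pos: "0 < S" "0 < w"
    and l: "\<And>s. 0 < s \<Longrightarrow> s < S \<Longrightarrow> 0 < l s \<and> l s \<le> 1"
    and g: "\<And>s. 0 \<le> g s"
    and dy: "\<And>s. 0 < s \<Longrightarrow> s < S \<Longrightarrow> (y has_real_derivative B s) (at s)"
    and dB: "\<And>s. 0 < s \<Longrightarrow> s < S \<Longrightarrow> (B has_real_derivative y s + w * A s / l s) (at s)"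
    and rel: "\<And>s. 0 < s \<Longrightarrow> s < S \<Longrightarrow> g s * y s = w * l s * A s - n s * B s"
  shows "0 < y S"
proof -
  have incr: "f 0 < f t"
    if "0 < t" "t \<le> S" "continuous_on {0..S} f"
      "\<And>s. 0 < s \<Longrightarrow> s < t \<Longrightarrow> (f has_real_derivative f' s) (at s) \<and> 0 < f' s"
    for f f' :: "real \<Rightarrow> real" and t
    by (rule DERIV_pos_imp_increasing_open[OF that(1)])
      (use that in \<open>auto intro: continuous_on_subset\<close>)
  have near_0: "\<exists>\<delta>>0. \<forall>s. 0 \<le> s \<and> s \<le> S \<and> s < \<delta> \<longrightarrow> \<bar>f s - f 0\<bar> < \<epsilon>"
    if "continuous_on {0..S} f" "0 < \<epsilon>" for f :: "real \<Rightarrow> real" and \<epsilon>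
  proof -
    have "\<exists>\<delta>>0. \<forall>s\<in>{0..S}. dist s 0 < \<delta> \<longrightarrow> dist (f s) (f 0) < \<epsilon>"
      using that(1)[unfolded continuous_on_iff, THEN bspec, of 0] that(2) pos by force
    then show ?thesis by (fastforce simp: dist_real_def)
  qed
  \<comment> \<open>\<open>l\<close> may tend to 0 at the start, where the derivative of
    \<open>B\<close> is then uncontrolled; as \<open>l \<le> 1\<close>, the continuous
    \<open>y + w * A\<close> bounds it from below while \<open>A > 0\<close>.\<close>
  have "continuous_on {0..S} (\<lambda>s. y s + w * A s)"
    by (intro continuous_intros cont)
  from near_0[OF this, of w] obtain \<delta> where "0 < \<delta>"
    and \<delta>: "\<And>s. 0 \<le> s \<Longrightarrow> s \<le> S \<Longrightarrow> s < \<delta> \<Longrightarrow> 0 < y s + w * A s"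
    using pos init by (force simp: abs_less_iff)
  from near_0[OF cont(3), of 1] obtain \<delta>' where "0 < \<delta>'"
    and \<delta>': "\<And>s. 0 \<le> s \<Longrightarrow> s \<le> S \<Longrightarrow> s < \<delta>' \<Longrightarrow> 0 < A s"
    using init by (auto simp: abs_less_iff)
  define t where "t = Min {\<delta>, \<delta>', S}"
  have t: "0 < t" "t \<le> \<delta>" "t \<le> \<delta>'" "t \<le> S"
    using \<open>0 < \<delta>\<close> \<open>0 < \<delta>'\<close> pos by (auto simp: t_def)
  have near: "0 < B s" if "0 < s" "s \<le> t" for s
  proof -
    have "B 0 < B s"
    proof (rule incr[where f' = "\<lambda>s. y s + w * A s / l s"])
      fix u assume u: "0 < u" "u < s"
      then have uS: "u < S" using that t by simp
      have "0 < A u" using \<delta>'[of u] u that t uS by auto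
      then have "w * A u \<le> w * A u / l u"
        using l[of u] u uS pos by (simp add: pos_le_divide_eq mult_left_le)
      moreover have "0 < y u + w * A u"
        using \<delta>[of u] u that t uS by auto
      ultimately show "(B has_real_derivative y u + w * A u / l u) (at u) \<and> 0 < y u + w * A u / l u"
        using dB[of u] u uS by simp
    qed (use that t cont in auto)
    then show ?thesis using init by simp
  qed
  have Bpos: "0 < B s" if "0 < s" "s < S" for s
  proof (rule ccontr)
    assume neg: "\<not> 0 < B s"
    have "t < s" using near neg that by force
    \<comment> \<open>The search for a first zero starts at \<open>t\<close>, because
      \<open>B 0 = 0\<close> would put 0 itself into the set.\<close>
    define Z where "Z = {u \<in> {t..s}. B u \<le> 0}"
    have "closed Z"
    proof -
      have "continuous_on {t..s} B"
        using that t by (intro continuous_on_subset[OF cont(2)]) auto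
      then have "closed ({t..s} \<inter> B -` {..0})"
        by (intro continuous_closed_preimage) auto
      moreover have "Z = {t..s} \<inter> B -` {..0}" by (auto simp: Z_def)
      ultimately show ?thesis by simp
    qed
    have bdd: "bdd_below Z" by (auto simp: Z_def intro: bdd_belowI[of _ t])
    have "s \<in> Z" using \<open>t < s\<close> neg by (auto simp: Z_def)
    define u where "u = Inf Z"
    have "u \<in> Z"
      unfolding u_def using closed_contains_Inf[OF _ bdd \<open>closed Z\<close>] \<open>s \<in> Z\<close> by auto
    then have u: "t < u" "u \<le> s" "B u \<le> 0"
      using near[of t] t by (auto simp: Z_def less_le)
    have before: "0 < B v" if "0 < v" "v < u" for v
    proof (cases "v \<le> t")
      case False
      have "v \<notin> Z" using cInf_lower[OF _ bdd, of v] that by (auto simp: u_def)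
      then show ?thesis using False that u by (auto simp: Z_def)
    qed (use near that in auto)
    have uS: "0 < u" "u < S" using u t that by auto
    have "y 0 < y u"
      by (rule incr[where f' = B]) (use uS before dy cont in auto)
    then have "0 < y u" using init by simp
    have dBu: "B u = 0"
    proof (rule ccontr)
      assume "B u \<noteq> 0"
      then have "B u < 0" using u by simp
      then obtain v where "t \<le> v" "v \<le> u" "B v = 0"
        using IVT2'[of B u 0 t] near[of t] t u uS
          continuous_on_subset[OF cont(2), of "{t..u}"] by force
      then show False using before[of v] t u \<open>B u < 0\<close> by (cases "v = u") auto
    qed
    then have "g u * y u = w * l u * A u" using rel uS by simp
    moreover have "0 \<le> g u * y u" using g \<open>0 < y u\<close> by simp
    moreover have "0 < w * l u" using l[OF uS] pos by simp
    ultimately have "0 \<le> A u" by (metis mult_pos_neg not_le)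
    then have "0 < y u + w * A u / l u" using \<open>0 < y u\<close> l[OF uS] pos
      by (simp add: add_pos_nonneg)
    then obtain d where "0 < d" and d: "\<And>h. 0 < h \<Longrightarrow> h < d \<Longrightarrow> B (u - h) < B u"
      using DERIV_pos_inc_left[OF dB[OF uS]] by auto
    obtain h where "0 < h" "h < d" "h < u"
      using field_lbound_gt_zero[OF \<open>0 < d\<close> \<open>0 < u\<close>] by blast
    then show False using d[of h] before[of "u - h"] dBu by simp
  qed
  have "y 0 < y S"
    by (rule incr[where f' = B]) (use pos Bpos dy cont in auto)
  then show ?thesis using init by simp
qed

text \<open>
  \<open>(r1 s, r2 s, r3 s)\<close> is the third row of \<open>R s\<close>, and \<open>a, b, d, e\<close> are the initial values of
  \<open>\<lambda>\<^sub>1, \<lambda>\<^sub>2, \<lambda>\<^sub>4, \<lambda>\<^sub>5\<close>.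
\<close>
locale cusp_to_cusp =
  fixes a b d e S :: real and l3 r1 r2 r3 z :: "real \<Rightarrow> real"
  fixes l1 l2 l4 l5 n :: "real \<Rightarrow> real"
  defines "l1 \<equiv> \<lambda>s. a * cosh s - e * sinh s"
    and "l2 \<equiv> \<lambda>s. b * cosh s + d * sinh s"
    and "l4 \<equiv> \<lambda>s. d * cosh s + b * sinh s"
    and "l5 \<equiv> \<lambda>s. e * cosh s - a * sinh s"
    and "n \<equiv> \<lambda>s. l1 s * l5 s - l2 s * l4 s"
  assumes S_pos: "0 < S"
    and l3_eq: "\<And>s. 0 \<le> s \<Longrightarrow> s \<le> S \<Longrightarrow> l3 s = sqrt (1 - (l4 s)\<^sup>2 - (l5 s)\<^sup>2)"
    and l3_pos: "\<And>s. 0 < s \<Longrightarrow> s < S \<Longrightarrow> 0 < l3 s"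
    and l3_ends: "l3 0 = 0" "l3 S = 0"
    and c_pos: "0 < a\<^sup>2 + b\<^sup>2"
    and r_init: "r1 0 = 0" "r2 0 = 0" "r3 0 = 1" "z 0 = 0"
    and r_unit: "\<And>s. 0 \<le> s \<Longrightarrow> s \<le> S \<Longrightarrow> (r1 s)\<^sup>2 + (r2 s)\<^sup>2 + (r3 s)\<^sup>2 = 1"
    and cont: "continuous_on {0..S} r1" "continuous_on {0..S} r2"
      "continuous_on {0..S} r3" "continuous_on {0..S} z"
    and dz: "\<And>s. 0 < s \<Longrightarrow> s < S \<Longrightarrow> (z has_real_derivative r3 s) (at s)"
    and dr1: "\<And>s. 0 < s \<Longrightarrow> s < S \<Longrightarrow> (r1 has_real_derivative - (l5 s * r3 s) / l3 s) (at s)"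
    and dr2: "\<And>s. 0 < s \<Longrightarrow> s < S \<Longrightarrow> (r2 has_real_derivative l4 s * r3 s / l3 s) (at s)"
    and dr3: "\<And>s. 0 < s \<Longrightarrow> s < S \<Longrightarrow>
      (r3 has_real_derivative (l5 s * r1 s - l4 s * r2 s) / l3 s) (at s)"
begin

section \<open>Momentum and its first integrals\<close>

lemma dl:
  "(l1 has_real_derivative - l5 s) (at s)" "(l2 has_real_derivative l4 s) (at s)"
  "(l4 has_real_derivative l2 s) (at s)" "(l5 has_real_derivative - l1 s) (at s)"
  unfolding l1_def l2_def l4_def l5_def
  by (auto intro!: derivative_eq_intros simp: algebra_simps)

lemma cont_l:
  "continuous_on A l1" "continuous_on A l2" "continuous_on A l4" "continuous_on A l5"
  unfolding l1_def l2_def l4_def l5_def by (intro continuous_intros)+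

lemma cont_l3: "continuous_on {0..S} l3"
proof -
  have "continuous_on {0..S} (\<lambda>s. sqrt (1 - (l4 s)\<^sup>2 - (l5 s)\<^sup>2))"
    by (intro continuous_intros cont_l)
  then show ?thesis by (rule continuous_on_eq) (use l3_eq in auto)
qed

lemmas conts = cont cont_l cont_l3

lemma init: "l1 0 = a" "l2 0 = b" "l4 0 = d" "l5 0 = e" "n 0 = a * e - b * d"
  by (auto simp: l1_def l2_def l4_def l5_def n_def)

lemma de: "d\<^sup>2 + e\<^sup>2 = 1"
  using l3_eq[of 0] l3_ends S_pos by (simp add: init)

lemma l3_sq:
  assumes "0 \<le> s" "s \<le> S"
  shows "(l3 s)\<^sup>2 = 1 - (l4 s)\<^sup>2 - (l5 s)\<^sup>2"
\<comment> \<open>\<open>sqrt\<close> is odd on the reals: a positive value forces a positive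
  radicand, and the value 0 a zero one.\<close>
proof (cases "s = 0 \<or> s = S")
  case True
  then have "l3 s = 0" using l3_ends by auto
  then show ?thesis using l3_eq[OF assms] by simp
next
  case False
  then have "0 < l3 s" using assms l3_pos by auto
  then have "0 \<le> 1 - (l4 s)\<^sup>2 - (l5 s)\<^sup>2" using l3_eq[OF assms] by auto
  then show ?thesis using l3_eq[OF assms] by simp
qed

lemma l3_le_1: "0 \<le> s \<Longrightarrow> s \<le> S \<Longrightarrow> l3 s \<le> 1"
  using l3_sq[of s] by (auto intro: power2_le_imp_le)

text \<open>(\<open>l1\<close>, \<open>l5\<close>) and (\<open>l2\<close>, \<open>l4\<close>) move
  by hyperbolic rotations, which preserve \<open>l1^2 - l5^2\<close> and
  \<open>l2^2 - l4^2\<close>.\<close>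

lemma casimir:
  assumes "0 \<le> s" "s \<le> S"
  shows "(l1 s)\<^sup>2 + (l2 s)\<^sup>2 + (l3 s)\<^sup>2 = a\<^sup>2 + b\<^sup>2"
proof -
  have "(l1 s)\<^sup>2 + (l2 s)\<^sup>2 - (l4 s)\<^sup>2 - (l5 s)\<^sup>2
      = (a\<^sup>2 + b\<^sup>2 - (d\<^sup>2 + e\<^sup>2)) * ((cosh s)\<^sup>2 - (sinh s)\<^sup>2)"
    unfolding l1_def l2_def l4_def l5_def by (simp add: algebra_simps power2_eq_square)
  then show ?thesis using l3_sq[OF assms] de hyperbolic_pythagoras[of s] by simp
qed

lemma W_const: "- l1 s * l4 s - l2 s * l5 s = - a * d - b * e"
proof -
  have "- l1 s * l4 s - l2 s * l5 s = (- a * d - b * e) * ((cosh s)\<^sup>2 - (sinh s)\<^sup>2)"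
    unfolding l1_def l2_def l4_def l5_def by (simp add: algebra_simps power2_eq_square)
  then show ?thesis using hyperbolic_pythagoras[of s] by simp
qed

lemma dl3:
  assumes "0 < s" "s < S"
  shows "(l3 has_real_derivative n s / l3 s) (at s)"
proof -
  let ?f = "\<lambda>s. sqrt (1 - (l4 s)\<^sup>2 - (l5 s)\<^sup>2)"
  have "0 < l3 s" "l3 s = ?f s" using assms l3_pos l3_eq by auto
  moreover from this have "0 < 1 - (l4 s)\<^sup>2 - (l5 s)\<^sup>2" by simp
  ultimately have "(?f has_real_derivative n s / l3 s) (at s)"
    by (auto intro!: derivative_eq_intros dl simp: n_def field_simps)
  then show ?thesis
    by (rule has_field_derivative_transform_within_open[of _ _ _ "{0<..<S}"])
      (use assms l3_eq in auto)
qed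

section \<open>Conservation laws and the height between the cusps\<close>

text \<open>This is the third component of the conserved linear momentum, which is horizontal
  because the geodesic departs from a cusp.\<close>

lemma r_orthogonal:
  assumes "0 \<le> s" "s \<le> S"
  shows "l1 s * r1 s + l2 s * r2 s + l3 s * r3 s = 0"
proof -
  let ?f = "\<lambda>s. l1 s * r1 s + l2 s * r2 s + l3 s * r3 s"
  have "?f s = ?f 0"
  proof (rule constant_on_closed_interval[OF _ _ assms])
    show "continuous_on {0..S} ?f" by (intro continuous_intros conts)
    fix s assume s: "0 < s" "s < S"
    then show "(?f has_real_derivative 0) (at s)"
      using l3_pos[OF s]
      by (auto intro!: derivative_eq_intros dl dl3 dr1 dr2 dr3 simp: n_def field_simps)
  qed
  then show ?thesis using r_init l3_ends by simp
qed

text \<open>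
  In the fixed frame the linear momentum \<open>P = (a, b, 0)\<close> and the angular momentum
  \<open>R (\<lambda>\<^sub>4, \<lambda>\<^sub>5, 0) + x \<times> P\<close> are conserved; this is the third component of the cross product
  of \<open>P\<close> with the latter.
\<close>
lemma z_eq:
  assumes "0 \<le> s" "s \<le> S"
  shows "(a\<^sup>2 + b\<^sup>2) * z s = n 0 - (l3 s * (l4 s * r2 s - l5 s * r1 s) + n s * r3 s)"
proof -
  let ?f = "\<lambda>s. (a\<^sup>2 + b\<^sup>2) * z s + (l3 s * (l4 s * r2 s - l5 s * r1 s) + n s * r3 s)"
  have dn: "(n has_real_derivative - ((l1 s)\<^sup>2 + (l2 s)\<^sup>2 + (l4 s)\<^sup>2 + (l5 s)\<^sup>2)) (at s)" for s
    unfolding n_def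
    by (auto intro!: derivative_eq_intros dl simp: power2_eq_square)
  have "?f s = ?f 0"
  proof (rule constant_on_closed_interval[OF _ _ assms])
    show "continuous_on {0..S} ?f" unfolding n_def by (intro continuous_intros conts)
    fix s assume s: "0 < s" "s < S"
    have "(?f has_real_derivative (a\<^sup>2 + b\<^sup>2) * r3 s + (n s / l3 s * (l4 s * r2 s - l5 s * r1 s)
        + l3 s * (l2 s * r2 s + l4 s * (l4 s * r3 s / l3 s)
             - (- l1 s * r1 s + l5 s * (- (l5 s * r3 s) / l3 s)))
        + (n s * ((l5 s * r1 s - l4 s * r2 s) / l3 s)
             - ((l1 s)\<^sup>2 + (l2 s)\<^sup>2 + (l4 s)\<^sup>2 + (l5 s)\<^sup>2) * r3 s))) (at s)"
      by (auto intro!: derivative_eq_intros dl dl3 dr1 dr2 dr3 dz dn s simp: algebra_simps)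
    also have "(a\<^sup>2 + b\<^sup>2) * r3 s + (n s / l3 s * (l4 s * r2 s - l5 s * r1 s)
        + l3 s * (l2 s * r2 s + l4 s * (l4 s * r3 s / l3 s)
             - (- l1 s * r1 s + l5 s * (- (l5 s * r3 s) / l3 s)))
        + (n s * ((l5 s * r1 s - l4 s * r2 s) / l3 s)
             - ((l1 s)\<^sup>2 + (l2 s)\<^sup>2 + (l4 s)\<^sup>2 + (l5 s)\<^sup>2) * r3 s))
      = (a\<^sup>2 + b\<^sup>2) * r3 s + l3 s * (l1 s * r1 s + l2 s * r2 s) - ((l1 s)\<^sup>2 + (l2 s)\<^sup>2) * r3 s"
      using l3_pos[OF s] by (simp add: field_simps power2_eq_square)
    also have "l1 s * r1 s + l2 s * r2 s = - l3 s * r3 s"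
      using r_orthogonal[of s] s by simp
    also have "(a\<^sup>2 + b\<^sup>2) * r3 s + l3 s * (- l3 s * r3 s) - ((l1 s)\<^sup>2 + (l2 s)\<^sup>2) * r3 s = 0"
      using casimir[of s, symmetric] s by (simp add: algebra_simps power2_eq_square)
    finally show "(?f has_real_derivative 0) (at s)" .
  qed
  then show ?thesis using r_init l3_ends by simp
qed

text \<open>Since \<open>l4^2 + l5^2 = 1\<close> also holds at 0, the same equation at
  \<open>S\<close> has the factor \<open>sinh S\<close>; the other factor gives
  \<open>tanh S = 2 * n 0 / (1 + a^2 + b^2)\<close>, which yields both claims.\<close>

lemma n_end: "0 < n 0" "n S = - n 0"
proof -
  have "(l4 S)\<^sup>2 + (l5 S)\<^sup>2
      = (d\<^sup>2 + e\<^sup>2) * (cosh S)\<^sup>2 + (a\<^sup>2 + b\<^sup>2) * (sinh S)\<^sup>2 - 2 * n 0 * sinh S * cosh S"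
    unfolding init l4_def l5_def by (simp add: algebra_simps power2_eq_square)
  also have "\<dots> = 1 + sinh S * ((1 + a\<^sup>2 + b\<^sup>2) * sinh S - 2 * n 0 * cosh S)"
    unfolding de cosh_square_eq by (simp add: algebra_simps power2_eq_square)
  moreover have "(l4 S)\<^sup>2 + (l5 S)\<^sup>2 = 1" using l3_sq[of S] l3_ends S_pos by simp
  ultimately have "sinh S * ((1 + a\<^sup>2 + b\<^sup>2) * sinh S - 2 * n 0 * cosh S) = 0" by linarith
  then have *: "(1 + a\<^sup>2 + b\<^sup>2) * sinh S = 2 * n 0 * cosh S" using S_pos by simp
  have "0 < (1 + a\<^sup>2 + b\<^sup>2) * sinh S" using c_pos S_pos by (intro mult_pos_pos) auto
  then show "0 < n 0" unfolding * using cosh_real_pos[of S] by (simp add: zero_less_mult_iff)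
  have "n S = n 0 * ((cosh S)\<^sup>2 + (sinh S)\<^sup>2) - cosh S * ((d\<^sup>2 + e\<^sup>2 + a\<^sup>2 + b\<^sup>2) * sinh S)"
    unfolding init n_def l1_def l2_def l4_def l5_def
    by (simp add: algebra_simps power2_eq_square)
  also have "\<dots> = - n 0 * ((cosh S)\<^sup>2 - (sinh S)\<^sup>2)"
    unfolding de * by (simp add: algebra_simps power2_eq_square)
  finally show "n S = - n 0" by (simp add: hyperbolic_pythagoras)
qed

lemma z_pos:
  assumes "0 < s" "s < S"
  shows "0 < z s"
proof -
  define X where "X = l3 s * (l4 s * r2 s - l5 s * r1 s) + n s * r3 s"
  define M where "M = (l3 s)\<^sup>2 * ((l4 s)\<^sup>2 + (l5 s)\<^sup>2) + (n s)\<^sup>2"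
  have "X\<^sup>2 \<le> M * ((r1 s)\<^sup>2 + (r2 s)\<^sup>2 + (r3 s)\<^sup>2)"
  proof -
    \<comment> \<open>Lagrange's identity: \<open>p \<times> v = (- l3 * l5, l3 * l4, n)\<close> has
      squared norm \<open>M\<close>, and the squares on the right are the components of its cross
      product with \<open>r\<close>.\<close>
    have "M * ((r1 s)\<^sup>2 + (r2 s)\<^sup>2 + (r3 s)\<^sup>2) - X\<^sup>2 =
      (l3 s * (l5 s * r2 s + l4 s * r1 s))\<^sup>2 + (l3 s * l4 s * r3 s - n s * r2 s)\<^sup>2
        + (l3 s * l5 s * r3 s + n s * r1 s)\<^sup>2"
      unfolding X_def M_def by (simp add: algebra_simps power2_eq_square)
    then show ?thesis by (smt (verit) zero_le_power2)
  qed
  then have "X\<^sup>2 \<le> M" using r_unit assms by simp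
  also have "M = (n 0)\<^sup>2 - (a\<^sup>2 + b\<^sup>2) * (l3 s)\<^sup>2"
  proof -
    \<comment> \<open>For (\<open>l1\<close>, \<open>l2\<close>) and (\<open>l4\<close>,
      \<open>l5\<close>) the last square is \<open>W^2\<close>; its constancy links
      \<open>n s\<close> to \<open>n 0\<close>.\<close>
    have lagrange: "(p * t - q * u)\<^sup>2 = (p\<^sup>2 + q\<^sup>2) * (u\<^sup>2 + t\<^sup>2) - (- p * u - q * t)\<^sup>2"
      for p q t u :: real
      by (simp add: algebra_simps power2_eq_square)
    have l45: "(l4 s)\<^sup>2 + (l5 s)\<^sup>2 = 1 - (l3 s)\<^sup>2" using l3_sq[of s] assms by simp
    have l12: "(l1 s)\<^sup>2 + (l2 s)\<^sup>2 = a\<^sup>2 + b\<^sup>2 - (l3 s)\<^sup>2" using casimir[of s] assms by simp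
    have "(n s)\<^sup>2 = (a\<^sup>2 + b\<^sup>2 - (l3 s)\<^sup>2) * (1 - (l3 s)\<^sup>2) - (- a * d - b * e)\<^sup>2"
      using lagrange[of "l1 s" "l5 s" "l2 s" "l4 s"] unfolding W_const l12 l45 n_def .
    moreover have "(n 0)\<^sup>2 = a\<^sup>2 + b\<^sup>2 - (- a * d - b * e)\<^sup>2"
      using lagrange[of a e b d] unfolding init de by simp
    ultimately show ?thesis unfolding M_def l45 by (simp add: algebra_simps)
  qed
  also have "\<dots> < (n 0)\<^sup>2" using c_pos l3_pos[OF assms] by simp
  finally have "X < n 0" using n_end by (auto intro: power2_less_imp_less)
  then have "0 < (a\<^sup>2 + b\<^sup>2) * z s" using z_eq[of s] assms by (simp add: X_def)
  then show ?thesis using c_pos by (simp add: zero_less_mult_iff)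
qed

section \<open>The height at the end cusp\<close>

lemma z_end: "(a\<^sup>2 + b\<^sup>2) * z S = n 0 * (1 + r3 S)"
  using z_eq[of S] n_end l3_ends S_pos by (simp add: algebra_simps)

lemma z_end_zero_iff: "z S = 0 \<longleftrightarrow> r3 S = - 1"
  using z_end n_end c_pos by (smt (verit) mult_eq_0_iff)

lemma r3_end_twisted:
  assumes "- a * d - b * e \<noteq> 0"
  shows "r3 S \<noteq> - 1"
proof
  assume r3: "r3 S = - 1"
  define W where "W = - a * d - b * e"
  \<comment> \<open>By conservation of angular momentum, \<open>y\<close> is the displacement out of
    the vertical plane containing \<open>P = (a, b, 0)\<close>, scaled by the length of
    \<open>P\<close>.\<close>
  define y where "y s = r1 s * l4 s + r2 s * l5 s" for s
  define B where "B s = l2 s * r1 s - l1 s * r2 s" for s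
  have yB_0: "y 0 = 0" "B 0 = 0" by (simp_all add: y_def B_def r_init)
  have cont_yB: "continuous_on {0..S} y" "continuous_on {0..S} B"
    unfolding y_def B_def by (intro continuous_intros conts)+
  have dy: "(y has_real_derivative B s) (at s)" if "0 < s" "s < S" for s
    unfolding y_def B_def using l3_pos[OF that]
    by (auto intro!: derivative_eq_intros dl dr1 dr2 that simp: field_simps)
  have dB: "(B has_real_derivative y s + W * r3 s / l3 s) (at s)" if "0 < s" "s < S" for s
    unfolding y_def B_def W_def W_const[of s, symmetric] using l3_pos[OF that]
    by (auto intro!: derivative_eq_intros dl dr1 dr2 that simp: field_simps)
  have rel: "((l1 s)\<^sup>2 + (l2 s)\<^sup>2) * y s = W * l3 s * r3 s - n s * B s" if "0 < s" "s < S" for s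
  proof -
    \<comment> \<open>The inner product of (\<open>r1\<close>, \<open>r2\<close>) and
      (\<open>l4\<close>, \<open>l5\<close>) is resolved along (\<open>l1\<close>,
      \<open>l2\<close>) and its perpendicular.\<close>
    have "((l1 s)\<^sup>2 + (l2 s)\<^sup>2) * y s
        = - (l1 s * r1 s + l2 s * r2 s) * (- l1 s * l4 s - l2 s * l5 s) - n s * B s"
      unfolding y_def B_def n_def by (simp add: algebra_simps power2_eq_square)
    also have "- (l1 s * r1 s + l2 s * r2 s) = l3 s * r3 s"
      using r_orthogonal[of s] that by simp
    finally show ?thesis unfolding W_const W_def by (simp add: ac_simps)
  qed
  have "r1 S = 0 \<and> r2 S = 0" using r_unit[of S] r3 S_pos by (simp add: sum_power2_eq_zero_iff)
  then have "y S = 0" by (simp add: y_def)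
  have "W > 0 \<or> W < 0" using assms by (auto simp: W_def)
  then show False
  proof
    assume "W > 0"
    have "0 < y S"
      by (rule transversal_position_positive[where w = W and B = B and A = r3 and l = l3
            and g = "\<lambda>s. (l1 s)\<^sup>2 + (l2 s)\<^sup>2" and n = n])
        (use cont_yB cont yB_0 dy dB rel \<open>W > 0\<close> S_pos r_init l3_pos l3_le_1 in auto)
    then show False using \<open>y S = 0\<close> by simp
  next
    assume "W < 0"
    have "0 < - y S"
    proof (rule transversal_position_positive[where w = "- W" and y = "\<lambda>s. - y s"
          and B = "\<lambda>s. - B s" and A = r3 and l = l3
          and g = "\<lambda>s. (l1 s)\<^sup>2 + (l2 s)\<^sup>2" and n = n])
      fix s assume s: "0 < s" "s < S"
      show "((\<lambda>s. - y s) has_real_derivative - B s) (at s)"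
        by (intro derivative_intros dy s)
      show "((\<lambda>s. - B s) has_real_derivative - y s + - W * r3 s / l3 s) (at s)"
        using DERIV_minus[OF dB[OF s]] by simp
      show "((l1 s)\<^sup>2 + (l2 s)\<^sup>2) * - y s = - W * l3 s * r3 s - n s * - B s"
        using rel[OF s] by simp
    qed (use cont_yB cont yB_0 \<open>W < 0\<close> S_pos r_init l3_pos l3_le_1
          in \<open>auto intro: continuous_on_minus\<close>)
    then show False using \<open>y S = 0\<close> by simp
  qed
qed

text \<open>\<open>W = 0\<close> makes \<open>(a, b)\<close> orthogonal to \<open>(d, e)\<close>, so
  the rotation axis \<open>(d, e, 0)\<close> stays fixed and the momentum reduces to two scalar
  functions.\<close>

lemma r3_end_planar:
  assumes "- a * d - b * e = 0"
  shows "r3 S = - 1 \<longleftrightarrow> a\<^sup>2 + b\<^sup>2 < 1"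
proof -
  define c where "c = n 0"
  have "c > 0" using n_end by (simp add: c_def)
  have "c * e = a * (d\<^sup>2 + e\<^sup>2) + d * (- a * d - b * e)"
    "- c * d = b * (d\<^sup>2 + e\<^sup>2) + e * (- a * d - b * e)"
    unfolding c_def init by (simp_all add: algebra_simps power2_eq_square)
  then have ab: "a = c * e" "b = - c * d" unfolding assms de by simp_all
  have "a\<^sup>2 + b\<^sup>2 = c\<^sup>2 * (d\<^sup>2 + e\<^sup>2)"
    unfolding ab by (simp add: algebra_simps power2_eq_square)
  then have c2: "a\<^sup>2 + b\<^sup>2 = c\<^sup>2" by (simp add: de)
  \<comment> \<open>\<open>v = \<tau> v(0)\<close> and \<open>v' = \<sigma> v(0)\<close>: the initial velocity of \<open>v\<close> is \<open>- c v(0)\<close>.\<close>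
  define \<sigma> where "\<sigma> s = sinh s - c * cosh s" for s
  define \<tau> where "\<tau> s = cosh s - c * sinh s" for s
  have l: "l1 s = - e * \<sigma> s" "l2 s = d * \<sigma> s" "l4 s = d * \<tau> s" "l5 s = e * \<tau> s" for s
    unfolding l1_def l2_def l4_def l5_def \<sigma>_def \<tau>_def ab by (auto simp: algebra_simps)
  have n: "n s = - \<sigma> s * \<tau> s" for s
  proof -
    have "n s = - (d\<^sup>2 + e\<^sup>2) * \<sigma> s * \<tau> s"
      unfolding n_def l by (simp add: algebra_simps power2_eq_square)
    then show ?thesis by (simp add: de)
  qed
  have d\<sigma>: "(\<sigma> has_real_derivative \<tau> s) (at s)" for s
    unfolding \<sigma>_def \<tau>_def by (auto intro!: derivative_eq_intros)
  \<comment> \<open>This is \<open>r \<bullet> (p \<times> v(0))\<close>: as \<open>R\<close> fixes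
    \<open>v(0)\<close>, the vector \<open>R (p \<times> v(0))\<close> is conserved.\<close>
  let ?f = "\<lambda>s. l3 s * (d * r2 s - e * r1 s) - \<sigma> s * r3 s"
  have "?f S = ?f 0"
  proof (rule constant_on_closed_interval)
    show "continuous_on {0..S} ?f"
      unfolding \<sigma>_def by (intro continuous_intros conts)
    fix s assume s: "0 < s" "s < S"
    have "n s / l3 s * (d * r2 s - e * r1 s)
        + l3 s * (d * (l4 s * r3 s / l3 s) - e * (- (l5 s * r3 s) / l3 s))
        - (\<tau> s * r3 s + \<sigma> s * ((l5 s * r1 s - l4 s * r2 s) / l3 s))
      = (d\<^sup>2 + e\<^sup>2 - 1) * \<tau> s * r3 s"
      using l3_pos[OF s] unfolding n l by (simp add: field_simps power2_eq_square)
    also have "\<dots> = 0" using de by simp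
    finally show "(?f has_real_derivative 0) (at s)"
      by (auto intro!: derivative_eq_intros dl3 dr1 dr2 dr3 d\<sigma> s simp: algebra_simps)
  qed (use S_pos in auto)
  then have r3: "- \<sigma> S * r3 S = c"
    using l3_ends r_init by (simp add: \<sigma>_def[of 0])
  \<comment> \<open>Only \<open>\<sigma> S = c\<close> with \<open>r3 S = - 1\<close> and
    \<open>\<sigma> S = - c\<close> with \<open>r3 S = 1\<close> remain; the resulting value of
    \<open>\<tau> S\<close> tells on which side of 1 \<open>c\<close> lies.\<close>
  have "n S = - c" using n_end by (simp add: c_def)
  then have \<sigma>\<tau>: "\<sigma> S * \<tau> S = c" using n by simp
  have "(l1 S)\<^sup>2 + (l2 S)\<^sup>2 = (d\<^sup>2 + e\<^sup>2) * (\<sigma> S)\<^sup>2"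
    unfolding l by (simp add: algebra_simps power2_eq_square)
  then have "(\<sigma> S)\<^sup>2 = c\<^sup>2"
    using casimir[of S] l3_ends S_pos de c2 by simp
  then have "\<sigma> S = c \<or> \<sigma> S = - c" by (simp add: power2_eq_iff)
  moreover have "c < 1" if "\<sigma> S = c"
  proof -
    have "\<tau> S = 1" using \<sigma>\<tau> that \<open>c > 0\<close> by simp
    then have "sinh S = c * (cosh S + 1)" "cosh S - 1 = c * sinh S"
      using that by (auto simp: \<sigma>_def \<tau>_def algebra_simps)
    then have "cosh S - 1 = c\<^sup>2 * (cosh S + 1)" by (simp add: power2_eq_square)
    moreover have "0 < cosh S" by simp
    ultimately show ?thesis
      using \<open>c > 0\<close> by (smt (verit) mult_le_cancel_right1 one_le_power)
  qed
  moreover have "\<not> c < 1" if "\<sigma> S = - c"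
  proof
    assume "c < 1"
    have "c * (\<tau> S + 1) = 0" using \<sigma>\<tau> that by (simp add: algebra_simps)
    then have "\<tau> S = - 1" using \<open>c > 0\<close> by simp
    then have "cosh S + 1 = c * sinh S" by (simp add: \<tau>_def)
    also have "\<dots> \<le> sinh S" using \<open>c < 1\<close> S_pos by (simp add: mult_le_cancel_right2)
    also have "\<dots> < cosh S" by (simp add: sinh_less_cosh_real)
    finally show False by simp
  qed
  moreover have "a\<^sup>2 + b\<^sup>2 < 1 \<longleftrightarrow> c < 1"
    using c2 \<open>c > 0\<close> power_less_one_iff[of c 2] by simp
  moreover have "r3 S = - 1" if "\<sigma> S = c"
  proof -
    have "c * (r3 S + 1) = 0" using r3 that by (simp add: algebra_simps)
    then show ?thesis using \<open>c > 0\<close> by simp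
  qed
  moreover have "r3 S = 1" if "\<sigma> S = - c" using r3 that \<open>c > 0\<close> by simp
  ultimately show ?thesis by (metis one_neq_neg_one)
qed

lemma z_end_iff: "z S = 0 \<longleftrightarrow> - a * d - b * e = 0 \<and> a\<^sup>2 + b\<^sup>2 < 1"
  using z_end_zero_iff r3_end_twisted r3_end_planar by blast

end

section \<open>Transfer to geodesics in SE(3)\<close>

text \<open>At \<open>s = 0\<close> the height vanishes whatever \<open>W\<close> and
  \<open>c\<close> are, so the equivalence is stated for positive times and only its backward
  direction at 0.\<close>

theorem corollary8:
  fixes lam :: "real \<Rightarrow> real^6"
    and \<gamma> :: "real \<Rightarrow> (real^3) \<times> (real^3^3)"
    and smax :: real
  defines "z \<equiv> (\<lambda>s. fst (\<gamma> s) $ 3)"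
  assumes "cuspless_geodesic lam \<gamma> smax"
    and "(lam 0$1)\<^sup>2 + (lam 0$2)\<^sup>2 + (lam 0$3)\<^sup>2 \<noteq> 0"
    and "lam 0$3 = 0" and "lam smax$3 = 0"
  shows "(\<forall>s\<in>{0<..<smax}. 0 < z s) \<and>
    (\<forall>s\<in>{0<..smax}. z s = 0 \<longleftrightarrow>
       (W_integral (lam 0) = 0 \<and> s \<in> {0, smax} \<and> c_integral (lam 0) < 1)) \<and>
    (\<forall>s\<in>{0..smax}.
       (W_integral (lam 0) = 0 \<and> s \<in> {0, smax} \<and> c_integral (lam 0) < 1) \<longrightarrow> z s = 0)"
proof -
  define R where "R s = snd (\<gamma> s)" for s
  note momentum = assms(2)[unfolded cuspless_geodesic_def, THEN conjunct2, THEN conjunct1]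
  note geo = assms(2)[unfolded cuspless_geodesic_def, THEN conjunct2, THEN conjunct2]
  have smax: "0 < smax" using geo by blast
  have lam: "lam s$1 = lam 0$1 * cosh s - lam 0$5 * sinh s"
      "lam s$5 = lam 0$5 * cosh s - lam 0$1 * sinh s"
      "lam s$2 = lam 0$2 * cosh s + lam 0$4 * sinh s"
      "lam s$4 = lam 0$4 * cosh s + lam 0$2 * sinh s"
      "lam s$3 = sqrt (1 - (lam s$4)\<^sup>2 - (lam s$5)\<^sup>2)" if "0 \<le> s" "s \<le> smax" for s
    using bspec[OF momentum, of s] that unfolding atLeastAtMost_iff by blast+
  have \<gamma>0: "fst (\<gamma> 0) = 0" "R 0 = mat 1" using geo by (auto simp: R_def)
  have cont: "continuous_on {0..smax} \<gamma>" using geo by blast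
  have dx: "((\<lambda>s. fst (\<gamma> s)) has_vector_derivative R s *v axis 3 1) (at s)"
    and dR: "(R has_vector_derivative (1 / lam s$3) *\<^sub>R (R s ** so3_part (lam s))) (at s)"
    if "0 < s" "s < smax" for s
    using geo that by (auto simp: R_def[abs_def])
  \<comment> \<open>Right multiplication acts on each row of \<open>R\<close> separately, so the
    third row, which determines \<open>z\<close>, obeys a closed system.\<close>
  have dRij: "((\<lambda>s. R s$3$i) has_real_derivative (R s ** so3_part (lam s))$3$i / lam s$3) (at s)"
    if "0 < s" "s < smax" for s i
  proof -
    have "bounded_linear (\<lambda>M :: real^3^3. M$3$i)"
      by (intro bounded_linear_compose[OF bounded_linear_vec_nth bounded_linear_vec_nth])
    from bounded_linear.has_vector_derivative[OF this dR[OF that]] show ?thesis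
      by (simp add: has_real_derivative_iff_has_vector_derivative)
  qed
  \<comment> \<open>\<open>lam\<close> is known only on \<open>{0..smax}\<close>; its closed
    formulas, smooth on all reals, stand in for it.\<close>
  interpret cusp_to_cusp "lam 0$1" "lam 0$2" "lam 0$4" "lam 0$5" smax "\<lambda>s. lam s$3"
    "\<lambda>s. R s$3$1" "\<lambda>s. R s$3$2" "\<lambda>s. R s$3$3" z
    "\<lambda>s. lam 0$1 * cosh s - lam 0$5 * sinh s"
    "\<lambda>s. lam 0$2 * cosh s + lam 0$4 * sinh s"
    "\<lambda>s. lam 0$4 * cosh s + lam 0$2 * sinh s"
    "\<lambda>s. lam 0$5 * cosh s - lam 0$1 * sinh s"
    "\<lambda>s. (lam 0$1 * cosh s - lam 0$5 * sinh s) * (lam 0$5 * cosh s - lam 0$1 * sinh s)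
       - (lam 0$2 * cosh s + lam 0$4 * sinh s) * (lam 0$4 * cosh s + lam 0$2 * sinh s)"
  proof (unfold_locales; (rule reflexive)?)
    show "0 < smax" by fact
    show "lam 0$3 = 0" "lam smax$3 = 0" by fact+
    show "0 < (lam 0$1)\<^sup>2 + (lam 0$2)\<^sup>2"
      using assms(3,4) by (simp add: sum_power2_gt_zero_iff sum_power2_eq_zero_iff)
    show "R 0$3$1 = 0" "R 0$3$2 = 0" "R 0$3$3 = 1" "z 0 = 0"
      by (auto simp: \<gamma>0 mat_def z_def)
    show "continuous_on {0..smax} (\<lambda>s. R s$3$1)" "continuous_on {0..smax} (\<lambda>s. R s$3$2)"
      "continuous_on {0..smax} (\<lambda>s. R s$3$3)" "continuous_on {0..smax} z"
      unfolding R_def z_def by (intro continuous_intros cont)+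
    fix s :: real
    { assume "0 \<le> s" "s \<le> smax"
      then show "lam s$3 = sqrt (1 - (lam 0$4 * cosh s + lam 0$2 * sinh s)\<^sup>2
          - (lam 0$5 * cosh s - lam 0$1 * sinh s)\<^sup>2)"
        using lam by metis
      have "orthogonal_matrix (R s)"
        using geo \<open>0 \<le> s\<close> \<open>s \<le> smax\<close> by (auto simp: SE3_def R_def rotation_matrix_def mem_Times_iff)
      then have "(R s ** transpose (R s))$3$3 = 1"
        by (simp add: orthogonal_matrix_def mat_def)
      then show "(R s$3$1)\<^sup>2 + (R s$3$2)\<^sup>2 + (R s$3$3)\<^sup>2 = 1"
        by (simp add: matrix_matrix_mult_def transpose_def sum_3 power2_eq_square) }
    assume s: "0 < s" "s < smax"
    show "0 < lam s$3" using geo s by auto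
    have "((\<lambda>s. fst (\<gamma> s)$3) has_vector_derivative (R s *v axis 3 1)$3) (at s)"
      by (rule bounded_linear.has_vector_derivative[OF bounded_linear_vec_nth dx[OF s]])
    then show "(z has_real_derivative R s$3$3) (at s)"
      by (simp add: has_real_derivative_iff_has_vector_derivative z_def
          matrix_vector_mult_basis column_def)
    note l45 = lam(4)[OF s[THEN less_imp_le], symmetric] lam(2)[OF s[THEN less_imp_le], symmetric]
    show "((\<lambda>s. R s$3$1) has_real_derivative
        - ((lam 0$5 * cosh s - lam 0$1 * sinh s) * R s$3$3) / lam s$3) (at s)"
      using dRij[OF s, of 1] unfolding l45
      by (simp add: matrix_matrix_mult_def so3_part_def sum_3 mult.commute)
    show "((\<lambda>s. R s$3$2) has_real_derivative
        (lam 0$4 * cosh s + lam 0$2 * sinh s) * R s$3$3 / lam s$3) (at s)"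
      using dRij[OF s, of 2] unfolding l45
      by (simp add: matrix_matrix_mult_def so3_part_def sum_3 mult.commute)
    show "((\<lambda>s. R s$3$3) has_real_derivative
        ((lam 0$5 * cosh s - lam 0$1 * sinh s) * R s$3$1
          - (lam 0$4 * cosh s + lam 0$2 * sinh s) * R s$3$2) / lam s$3) (at s)"
      using dRij[OF s, of 3] unfolding l45
      by (simp add: matrix_matrix_mult_def so3_part_def sum_3 mult.commute)
  qed
  have "W_integral (lam 0) = 0 \<and> c_integral (lam 0) < 1 \<longleftrightarrow> z smax = 0"
    using z_end_iff assms(4) by (simp add: W_integral_def c_integral_def)
  moreover have "s = smax \<or> (0 < z s \<and> s \<notin> {0, smax})" if "0 < s" "s \<le> smax" for s
    using z_pos[of s] that by (cases "s = smax") auto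
  moreover have "z 0 = 0" by (rule r_init)
  ultimately show ?thesis
    using z_pos smax by (intro conjI ballI) (simp, force, blast)
qed

end
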